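(* Let $\{F_n\}_{n\in\mathbb Z^+}$ be a non-decreasing sequence of non-negative measurable functions on $\mathbb T^\infty$, and set $F(\chi)=\lim_{n\to\infty}F_n(\chi)$ for $\chi\in\mathbb T^\infty$. Then $$\lim_{n\to\infty}\lim_{T\to\infty}\frac1{2T}\int_{-T}^TF_n(\chi\,\mathfrak p^{-it})\,\mathrm dt=\lim_{T\to\infty}\frac1{2T}\int_{-T}^TF(\chi\,\mathfrak p^{-it})\,\mathrm dt$$ for almost every $\chi\in\mathbb T^\infty$.
   Context: $\mathbb T$ is the unit circle in $\mathbb C$, $\mathbb T^\infty=\mathbb T\times\mathbb T\times\cdots$ is the countably infinite-dimensional torus (a compact abelian group under coordinatewise multiplication), and "measurable" and "almost every" refer to its normalized Haar measure $m_\infty$ (the product of the normalized arclength measures). The Kronecker flow is $\mathfrak p^{-it}=(2^{-it},3^{-it},5^{-it},\dots)\in\mathbb T^\infty$ for $t\in\mathbb R$ (the coordinates run over the primes); $\chi\,\mathfrak p^{-it}$ is the product in the group $\mathbb T^\infty$. Non-negative functions may take the value $+\infty$, and the limits and integrals are understood in $[0,\infty]$. *)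

theory Defs
  imports "HOL-Probability.Probability" "HOL-Computational_Algebra.Primes"
begin

text \<open>Normalized arclength measure on the unit circle, with its Borel sets: the image of the
  uniform distribution on one period under the arclength parametrization.\<close>

definition circle_measure :: "complex measure" where
  "circle_measure =
     distr (uniform_measure lborel {0..2 * pi}) (restrict_space borel (sphere 0 1)) cis"

definition torus :: "(nat \<Rightarrow> complex) set" where
  "torus = (\<Pi>\<^sub>E j\<in>UNIV. sphere 0 1)"

definition torus_mult :: "(nat \<Rightarrow> complex) \<Rightarrow> (nat \<Rightarrow> complex) \<Rightarrow> nat \<Rightarrow> complex" where
  "torus_mult z w = (\<lambda>j. z j * w j)"

text \<open>The completion makes every Haar measurable set (not only every Borel set) measurable.\<close>

definition torus_haar :: "(nat \<Rightarrow> complex) measure" where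
  "torus_haar = completion (\<Pi>\<^sub>M j\<in>UNIV. circle_measure)"

text \<open>Coordinate \<open>j\<close>, counted from 0, belongs to the \<open>j\<close>-th prime in increasing order.\<close>

definition kronecker_flow :: "real \<Rightarrow> nat \<Rightarrow> complex" where
  "kronecker_flow t =
     (\<lambda>j. complex_of_nat (enumerate {p. prime p} j) powr (- (\<i> * complex_of_real t)))"

text \<open>Meaningful for \<open>T > 0\<close> only. The nonnegative integral is total in Isabelle; that the
  integrand is measurable has to be stated separately.\<close>

definition flow_mean :: "((nat \<Rightarrow> complex) \<Rightarrow> ennreal) \<Rightarrow> (nat \<Rightarrow> complex) \<Rightarrow> real \<Rightarrow> ennreal" where
  "flow_mean f z T =
     (\<integral>\<^sup>+ t\<in>{-T..T}. f (torus_mult z (kronecker_flow t)) \<partial>lebesgue) / ennreal (2 * T)"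

lemma space_circle_measure: "space circle_measure = sphere 0 1"
  by (simp add: circle_measure_def space_restrict_space)

lemma space_torus_haar: "space torus_haar = torus"
  by (simp add: torus_haar_def torus_def space_PiM space_circle_measure)

lemma prob_space_circle_measure: "prob_space circle_measure"
  unfolding circle_measure_def
proof (rule prob_space.prob_space_distr)
  show "prob_space (uniform_measure lborel {0..2 * pi})"
    by (rule prob_space_uniform_measure) auto
  have "cis \<in> borel_measurable lborel"
    unfolding measurable_lborel2
    by (intro borel_measurable_continuous_onI continuous_intros)
  then show "cis \<in> uniform_measure lborel {0..2 * pi} \<rightarrow>\<^sub>M restrict_space borel (sphere 0 1)"
    by (intro measurable_restrict_space2) auto
qed

lemma prob_space_torus_haar: "prob_space torus_haar"
proof -
  interpret product_prob_space "\<lambda>_::nat. circle_measure" UNIV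
    by (rule product_prob_spaceI) (rule prob_space_circle_measure)
  have "emeasure (\<Pi>\<^sub>M j\<in>(UNIV::nat set). circle_measure) (space (\<Pi>\<^sub>M j\<in>UNIV. circle_measure)) = 1"
    by (rule P.emeasure_space_1)
  then show ?thesis
    unfolding torus_haar_def by (intro prob_spaceI) (simp add: emeasure_completion)
qed

lemma kronecker_flow_in_torus: "kronecker_flow t \<in> torus"
proof -
  have "enumerate {p::nat. prime p} j > 0" for j
    using enumerate_in_set[OF primes_infinite, of j] by (auto intro: prime_gt_0_nat)
  then show ?thesis
    by (auto simp: kronecker_flow_def torus_def norm_powr_real)
qed

end

theory Submission
  imports Defs
begin

text \<open>
  The flow \<open>\<chi> \<mapsto> \<chi> p\<^sup>-\<^sup>i\<^sup>t\<close> acts by translations of a compact group, so it preserves the Haar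
  measure, and the theorem is a pointwise ergodic theorem with a monotone parameter. It holds for
  every measurable flow on a finite measure space that preserves the measure
  (\<open>AE_convergent_means_completion\<close>).

  The core is a statement about one measure preserving map \<open>T\<close>. Suppose that every orbit has an initial
  segment along which the sum of \<open>b \<ge> 0\<close> is at most the sum of \<open>a \<ge> 0\<close>. Such segments tile every long orbit,
  and integration gives \<open>\<integral>b \<le> \<integral>a\<close> (\<open>nn_integral_le_of_orbit_sum_le\<close>). No subtraction
  occurs, so this holds for values and integrals in \<open>[0, \<infinity>]\<close>.

  Let \<open>g\<^sub>n\<close> increase to \<open>G\<close>. Consider the set of points where the supremum of the lower averages of
  the \<open>g\<^sub>n\<close> is below \<open>p\<close> and the upper average of \<open>G\<close> above \<open>q > p\<close>. Without a null set of points, whose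
  orbits meet infinite values of \<open>G\<close>, it is a set \<open>D\<close> that \<open>T\<close> maps into itself. The inequality above,
  with a constant as one of the two functions, gives \<open>\<integral>\<^sub>D g\<^sub>n \<le> p \<mu>(D)\<close> for every \<open>n\<close> and
  \<open>q \<mu>(D) \<le> \<integral>\<^sub>D G\<close>, so \<open>\<mu>(D) = 0\<close> by monotone convergence. Hence almost everywhere the upper average of
  \<open>G\<close> is at most the supremum of the lower averages of the \<open>g\<^sub>n\<close>
  (\<open>AE_limsup_average_le_SUP_liminf_average\<close>). This one inequality contains both the existence of
  all the limits and the exchange of limits.

  The passage to the flow samples it at integer times, forwards and backwards. The passage to the
  completed Haar measure uses that almost every orbit spends no time in a given null set.
\<close>

section \<open>Tiling an orbit and the maximal inequality\<close>

text \<open>Walk from \<^term>\<open>k\<close> to the right: at a point of \<^term>\<open>P\<close> jump over a window on which the sum of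
  \<^term>\<open>b\<close> is dominated, at any other point move by one. The windows are disjoint, and the last one
  overshoots \<^term>\<open>N\<close> by at most \<^term>\<open>n\<close>.\<close>

lemma sum_tiling_le:
  fixes a b :: "nat \<Rightarrow> ennreal"
  assumes "\<And>i. i \<in> P \<Longrightarrow> \<exists>j\<ge>1. j \<le> n \<and> sum b {i..<i+j} \<le> sum a {i..<i+j}"
  shows "sum b (P \<inter> {k..<N}) \<le> sum a {k..<N+n}"
proof (induction "N - k" arbitrary: k rule: less_induct)
  case less
  consider "N \<le> k" | "k < N" "k \<notin> P" | "k < N" "k \<in> P" by linarith
  then show ?case
  proof cases
    case 1
    then show ?thesis by simp
  next
    case 2
    have "P \<inter> {k..<N} = P \<inter> {Suc k..<N}"
      using 2 by (auto simp: Suc_le_eq order.order_iff_strict)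
    also have "sum b (P \<inter> {Suc k..<N}) \<le> sum a {Suc k..<N+n}"
      using less[of "Suc k"] 2 by simp
    also have "\<dots> \<le> sum a {k..<N+n}"
      by (intro sum_mono2) auto
    finally show ?thesis .
  next
    case 3
    from assms[OF \<open>k \<in> P\<close>] obtain j where
      j: "j \<ge> 1" "j \<le> n" "sum b {k..<k+j} \<le> sum a {k..<k+j}" by auto
    have "sum b (P \<inter> {k..<N}) \<le> sum b ({k..<k+j} \<union> (P \<inter> {k+j..<N}))"
      by (intro sum_mono2) auto
    also have "\<dots> = sum b {k..<k+j} + sum b (P \<inter> {k+j..<N})"
      by (intro sum.union_disjoint) auto
    also have "\<dots> \<le> sum a {k..<k+j} + sum a {k+j..<N+n}"
      using less[of "k+j"] 3 j by (intro add_mono) auto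
    also have "\<dots> = sum a {k..<N+n}"
      using 3 j by (intro sum.atLeastLessThan_concat) auto
    finally show ?thesis .
  qed
qed

lemma ennreal_le_of_mult_le_add:
  fixes x y :: ennreal
  assumes "\<And>N::nat. of_nat N * x \<le> of_nat (N + n) * y"
  shows "x \<le> y"
proof (cases "y = \<infinity>")
  case False
  then obtain y' where y': "y = ennreal y'" "y' \<ge> 0" by (cases y) auto
  have "x \<le> of_nat (1 + n) * y" using assms[of 1] by simp
  also have "\<dots> < \<infinity>" using False by (simp add: ennreal_mult_less_top of_nat_less_top less_top)
  finally obtain x' where x': "x = ennreal x'" "x' \<ge> 0" by (cases x) auto
  have *: "real N * x' \<le> real (N + n) * y'" for N
    using assms[of N] x' y'
    by (simp add: ennreal_of_nat_eq_real_of_nat flip: ennreal_mult ennreal_plus)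
  have "x' \<le> y'"
  proof (rule ccontr)
    assume "\<not> x' \<le> y'"
    then obtain N :: nat where "real n * y' < real N * (x' - y')"
      using reals_Archimedean3[of "x' - y'"] by auto
    with *[of N] show False by (simp add: algebra_simps)
  qed
  then show ?thesis using x' y' by (simp add: ennreal_leI)
qed simp

definition orbit_sum :: "('a \<Rightarrow> 'a) \<Rightarrow> ('a \<Rightarrow> ennreal) \<Rightarrow> nat \<Rightarrow> 'a \<Rightarrow> ennreal" where
  "orbit_sum T f n x = (\<Sum>i<n. f ((T ^^ i) x))"

lemma orbit_sum_Suc: "orbit_sum T f (Suc n) x = f x + orbit_sum T f n (T x)"
  by (simp add: orbit_sum_def sum.lessThan_Suc_shift funpow_swap1 del: sum.lessThan_Suc)

lemma orbit_sum_shift: "orbit_sum T f j ((T ^^ i) x) = (\<Sum>m\<in>{i..<i+j}. f ((T ^^ m) x))"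
proof -
  have "(\<Sum>m\<in>{i..<i+j}. f ((T ^^ m) x)) = (\<Sum>m\<in>{0..<j}. f ((T ^^ (m + i)) x))"
    using sum.shift_bounds_nat_ivl[of "\<lambda>m. f ((T ^^ m) x)" 0 i j] by (simp add: add.commute)
  then show ?thesis by (simp add: orbit_sum_def funpow_add lessThan_atLeast0)
qed

lemma orbit_sum_mono: "(\<And>y. f y \<le> g y) \<Longrightarrow> orbit_sum T f n x \<le> orbit_sum T g n x"
  by (auto simp: orbit_sum_def intro: sum_mono)

locale measure_preserving_map = finite_measure M for M :: "'a measure" +
  fixes T :: "'a \<Rightarrow> 'a"
  assumes T_measurable [measurable]: "T \<in> M \<rightarrow>\<^sub>M M"
    and distr_T: "distr M M T = M"
begin

lemma funpow_measurable [measurable]: "(T ^^ n) \<in> M \<rightarrow>\<^sub>M M"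
  by (induction n) (auto intro: measurable_comp simp: comp_def)

lemma distr_funpow: "distr M M (T ^^ n) = M"
proof (induction n)
  case 0
  then show ?case by (simp add: id_def distr_id)
next
  case (Suc n)
  have "distr M M (T ^^ Suc n) = distr (distr M M (T ^^ n)) M T"
    by (simp add: distr_distr)
  then show ?case by (simp add: Suc distr_T comp_def)
qed

lemma nn_integral_funpow:
  "f \<in> borel_measurable M \<Longrightarrow> (\<integral>\<^sup>+x. f ((T ^^ n) x) \<partial>M) = (\<integral>\<^sup>+x. f x \<partial>M)"
  using nn_integral_distr[of "T ^^ n" M M f] by (simp add: distr_funpow)

lemma funpow_space: "x \<in> space M \<Longrightarrow> (T ^^ n) x \<in> space M"
  using measurable_space[OF funpow_measurable] .

lemma orbit_sum_measurable [measurable]: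
  "f \<in> borel_measurable M \<Longrightarrow> orbit_sum T f n \<in> borel_measurable M"
  unfolding orbit_sum_def[abs_def]
  by (intro borel_measurable_sum measurable_compose[OF funpow_measurable])

lemma nn_integral_orbit_sum:
  assumes f: "f \<in> borel_measurable M"
  shows "(\<integral>\<^sup>+x. orbit_sum T f n x \<partial>M) = of_nat n * (\<integral>\<^sup>+x. f x \<partial>M)"
  unfolding orbit_sum_def
  using measurable_compose[OF funpow_measurable f]
  by (simp add: nn_integral_sum nn_integral_funpow f)

text \<open>A form of Hopf's maximal inequality that compares two non-negative functions and never
  subtracts, so infinite values and infinite integrals are allowed. Let \<open>P n\<close> be the set of points
  where a dominated window of length at most \<open>n\<close> begins. Tiling the orbit of \<open>x\<close> by such
  windows bounds the sum of \<open>b\<close> over the visits to \<open>P n\<close> before time \<open>N\<close> by the sum of \<open>a\<close> up to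
  time \<open>N + n\<close>. Integration turns these sums into multiples \<open>N\<close> and \<open>N + n\<close> of space integrals,
  and \<open>N \<rightarrow> \<infinity>\<close> removes the overshoot; finally the sets \<open>P n\<close> exhaust the space.\<close>

lemma nn_integral_le_of_orbit_sum_le:
  assumes [measurable]: "a \<in> borel_measurable M" "b \<in> borel_measurable M"
    and le: "\<And>x. x \<in> space M \<Longrightarrow> \<exists>j\<ge>1. orbit_sum T b j x \<le> orbit_sum T a j x"
  shows "(\<integral>\<^sup>+x. b x \<partial>M) \<le> (\<integral>\<^sup>+x. a x \<partial>M)"
proof -
  define P where "P n = {x\<in>space M. \<exists>j\<in>{1..n}. orbit_sum T b j x \<le> orbit_sum T a j x}" for n
  have [measurable]: "P n \<in> sets M" for n unfolding P_def by measurable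
  define b' where "b' n x = b x * indicator (P n) x" for n x
  have [measurable]: "b' n \<in> borel_measurable M" for n unfolding b'_def[abs_def] by measurable
  have bound: "(\<integral>\<^sup>+x. b' n x \<partial>M) \<le> (\<integral>\<^sup>+x. a x \<partial>M)" for n
  proof (rule ennreal_le_of_mult_le_add)
    fix N
    have "orbit_sum T (b' n) N x \<le> orbit_sum T a (N + n) x" if x: "x \<in> space M" for x
    proof -
      let ?P = "{i. (T ^^ i) x \<in> P n}"
      have "orbit_sum T (b' n) N x = (\<Sum>i\<in>{0..<N}. if i \<in> ?P then b ((T ^^ i) x) else 0)"
        unfolding orbit_sum_def b'_def lessThan_atLeast0 by (intro sum.cong) auto
      also have "\<dots> = (\<Sum>i\<in>?P \<inter> {0..<N}. b ((T ^^ i) x))"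
        by (subst sum.inter_restrict[symmetric]) (auto simp: Int_commute)
      also have "\<dots> \<le> (\<Sum>i\<in>{0..<N+n}. a ((T ^^ i) x))"
      proof (rule sum_tiling_le)
        fix i assume "i \<in> ?P"
        then show "\<exists>j\<ge>1. j \<le> n \<and> (\<Sum>m\<in>{i..<i+j}. b ((T ^^ m) x)) \<le> (\<Sum>m\<in>{i..<i+j}. a ((T ^^ m) x))"
          by (auto simp: P_def orbit_sum_shift)
      qed
      finally show ?thesis by (simp add: orbit_sum_def lessThan_atLeast0)
    qed
    then have "(\<integral>\<^sup>+x. orbit_sum T (b' n) N x \<partial>M) \<le> (\<integral>\<^sup>+x. orbit_sum T a (N + n) x \<partial>M)"
      by (intro nn_integral_mono)
    then show "of_nat N * (\<integral>\<^sup>+x. b' n x \<partial>M) \<le> of_nat (N + n) * (\<integral>\<^sup>+x. a x \<partial>M)"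
      by (simp only: nn_integral_orbit_sum \<open>b' n \<in> _\<close> assms(1))
  qed
  have "(SUP n. b' n x) = b x" if x: "x \<in> space M" for x
  proof (rule antisym)
    show "(SUP n. b' n x) \<le> b x"
      by (intro SUP_least) (auto simp: b'_def indicator_def)
    from le[OF x] obtain j where "j \<ge> 1" "orbit_sum T b j x \<le> orbit_sum T a j x" by blast
    then have "x \<in> P j" using x by (auto simp: P_def)
    then have "b x = b' j x" by (simp add: b'_def)
    then show "b x \<le> (SUP n. b' n x)" using SUP_upper[of j UNIV "\<lambda>n. b' n x"] by simp
  qed
  then have "(\<integral>\<^sup>+x. b x \<partial>M) = (\<integral>\<^sup>+x. (SUP n. b' n x) \<partial>M)"
    by (intro nn_integral_cong) simp
  also have "\<dots> = (SUP n. \<integral>\<^sup>+x. b' n x \<partial>M)"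
    by (intro nn_integral_monotone_convergence_SUP)
       (auto simp: incseq_def le_fun_def b'_def P_def indicator_def)
  also have "\<dots> \<le> (\<integral>\<^sup>+x. a x \<partial>M)"
    by (intro SUP_least bound)
  finally show ?thesis .
qed

lemma orbit_sum_forward_invariant:
  assumes "x \<in> D" "\<And>y. y \<in> D \<Longrightarrow> T y \<in> D"
  shows "orbit_sum T (\<lambda>y. f y * indicator D y) n x = orbit_sum T f n x"
proof -
  have "(T ^^ i) x \<in> D" for i using assms by (induction i) auto
  then show ?thesis by (simp add: orbit_sum_def)
qed

lemma orbit_sum_const: "orbit_sum T (\<lambda>_. c) n x = c * of_nat n"
  by (simp add: orbit_sum_def mult.commute)

text \<open>On a forward invariant set \<open>D\<close> the orbit sums of \<open>f\<close> restricted to \<open>D\<close> are those of \<open>f\<close>, and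
  outside \<open>D\<close> the window of length one is trivially dominated; so the maximal inequality applies to
  \<open>f\<close> and a constant, both restricted to \<open>D\<close>.\<close>

lemma nn_integral_le_of_average_le:
  assumes [measurable]: "f \<in> borel_measurable M" "D \<in> sets M"
    and inv: "\<And>x. x \<in> D \<Longrightarrow> T x \<in> D"
    and le: "\<And>x. x \<in> D \<Longrightarrow> \<exists>j\<ge>1. orbit_sum T f j x \<le> p * of_nat j"
  shows "(\<integral>\<^sup>+x\<in>D. f x \<partial>M) \<le> p * emeasure M D"
proof -
  have "(\<integral>\<^sup>+x. f x * indicator D x \<partial>M) \<le> (\<integral>\<^sup>+x. p * indicator D x \<partial>M)"
  proof (rule nn_integral_le_of_orbit_sum_le)
    fix x assume "x \<in> space M"
    show "\<exists>j\<ge>1. orbit_sum T (\<lambda>y. f y * indicator D y) j x \<le> orbit_sum T (\<lambda>y. p * indicator D y) j x"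
    proof (cases "x \<in> D")
      case True
      then show ?thesis using le[OF True] by (simp add: orbit_sum_forward_invariant inv orbit_sum_const)
    next
      case False
      then show ?thesis by (intro exI[of _ 1]) (simp add: orbit_sum_def)
    qed
  qed measurable
  then show ?thesis by (simp add: nn_integral_cmult_indicator)
qed

lemma nn_integral_ge_of_average_ge:
  assumes [measurable]: "f \<in> borel_measurable M" "D \<in> sets M"
    and inv: "\<And>x. x \<in> D \<Longrightarrow> T x \<in> D"
    and le: "\<And>x. x \<in> D \<Longrightarrow> \<exists>j\<ge>1. q * of_nat j \<le> orbit_sum T f j x"
  shows "q * emeasure M D \<le> (\<integral>\<^sup>+x\<in>D. f x \<partial>M)"
proof -
  have "(\<integral>\<^sup>+x. q * indicator D x \<partial>M) \<le> (\<integral>\<^sup>+x. f x * indicator D x \<partial>M)"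
  proof (rule nn_integral_le_of_orbit_sum_le)
    fix x assume "x \<in> space M"
    show "\<exists>j\<ge>1. orbit_sum T (\<lambda>y. q * indicator D y) j x \<le> orbit_sum T (\<lambda>y. f y * indicator D y) j x"
    proof (cases "x \<in> D")
      case True
      then show ?thesis using le[OF True] by (simp add: orbit_sum_forward_invariant inv orbit_sum_const)
    next
      case False
      then show ?thesis by (intro exI[of _ 1]) (simp add: orbit_sum_def)
    qed
  qed measurable
  then show ?thesis by (simp add: nn_integral_cmult_indicator)
qed

end

section \<open>Upper and lower averages along an orbit\<close>

lemma liminf_mult_tendsto_1_le:
  fixes c u :: "nat \<Rightarrow> ennreal"
  assumes "c \<longlonglongrightarrow> 1"
  shows "liminf (\<lambda>n. c n * u n) \<le> liminf u"
proof -
  obtain r where r: "strict_mono r" "(u \<circ> r) \<longlonglongrightarrow> liminf u"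
    using liminf_subseq_lim by blast
  have "(\<lambda>n. (c \<circ> r) n * (u \<circ> r) n) \<longlonglongrightarrow> 1 * liminf u"
    using r(2)[unfolded comp_def] LIMSEQ_subseq_LIMSEQ[OF assms r(1), unfolded comp_def]
    unfolding comp_def by (intro tendsto_mult_ennreal) auto
  then have "liminf ((\<lambda>n. c n * u n) \<circ> r) = liminf u"
    by (intro lim_imp_Liminf) (auto simp: comp_def)
  then show ?thesis
    using liminf_subseq_mono[OF r(1), of "\<lambda>n. c n * u n"] by simp
qed

lemma tendsto_divide_Suc_0_ennreal:
  fixes c :: ennreal
  assumes "c < \<infinity>"
  shows "(\<lambda>n. c / of_nat (Suc n)) \<longlonglongrightarrow> 0"
proof -
  obtain c' where c': "c = ennreal c'" "c' \<ge> 0" using assms by (cases c) auto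
  have "(\<lambda>n. ennreal (c' / real (Suc n))) \<longlonglongrightarrow> ennreal 0"
    by (intro tendsto_ennrealI) real_asymp
  then show ?thesis using c' by (simp add: divide_ennreal ennreal_of_nat_eq_real_of_nat del: of_nat_Suc)
qed

text \<open>Dropping the first summand can only decrease the orbit sums, and the change of the divisor from
  \<open>N + 1\<close> to \<open>N\<close> is asymptotically negligible.\<close>

lemma liminf_average_shift_le:
  "liminf (\<lambda>N. orbit_sum T f N (T x) / of_nat N) \<le> liminf (\<lambda>N. orbit_sum T f N x / of_nat N)"
proof -
  define c :: "nat \<Rightarrow> ennreal" where "c N = ennreal (real (Suc N) / real N)" for N
  have c: "c \<longlonglongrightarrow> 1"
  proof -
    have "(\<lambda>N. real (Suc N) / real N) \<longlonglongrightarrow> 1" by real_asymp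
    then have "(\<lambda>N. ennreal (real (Suc N) / real N)) \<longlonglongrightarrow> ennreal 1" by (rule tendsto_ennrealI)
    then show ?thesis by (simp add: c_def[abs_def])
  qed
  have "orbit_sum T f N (T x) / of_nat N \<le> c N * (orbit_sum T f (N + 1) x / of_nat (N + 1))"
    if "N > 0" for N
  proof -
    have "c N * (orbit_sum T f (N + 1) x / of_nat (N + 1))
        = orbit_sum T f (N+1) x * (c N / of_nat (N + 1))"
      by (simp add: divide_ennreal_def mult_ac)
    also have "c N / of_nat (N + 1) = ennreal (1 / real N)"
      using that unfolding c_def ennreal_of_nat_eq_real_of_nat
      by (subst divide_ennreal) (simp_all del: of_nat_Suc)
    also have "\<dots> = 1 / of_nat N"
      using that by (simp add: divide_ennreal ennreal_of_nat_eq_real_of_nat flip: ennreal_1)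
    finally have "c N * (orbit_sum T f (N + 1) x / of_nat (N + 1)) = orbit_sum T f (N + 1) x / of_nat N"
      by (simp add: ennreal_times_divide)
    moreover have "orbit_sum T f N (T x) \<le> orbit_sum T f (N + 1) x"
      by (simp add: orbit_sum_Suc)
    ultimately show ?thesis by (simp add: divide_right_mono_ennreal)
  qed
  then have "liminf (\<lambda>N. orbit_sum T f N (T x) / of_nat N)
      \<le> liminf (\<lambda>N. c N * (orbit_sum T f (N + 1) x / of_nat (N + 1)))"
    by (intro Liminf_mono) (auto simp: eventually_sequentially intro: exI[of _ 1])
  also have "\<dots> \<le> liminf (\<lambda>N. orbit_sum T f (N + 1) x / of_nat (N + 1))"
    by (rule liminf_mult_tendsto_1_le[OF c])
  also have "\<dots> = liminf (\<lambda>N. orbit_sum T f N x / of_nat N)"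
    by (rule liminf_shift)
  finally show ?thesis .
qed

text \<open>Finiteness of the first summand is essential: an infinite \<^term>\<open>f x\<close> makes every
  average over a non-empty orbit segment from \<^term>\<open>x\<close> infinite, whatever happens from \<^term>\<open>T x\<close> on.\<close>

lemma limsup_average_le_shift:
  assumes "f x < \<infinity>"
  shows "limsup (\<lambda>N. orbit_sum T f N x / of_nat N) \<le> limsup (\<lambda>N. orbit_sum T f N (T x) / of_nat N)"
proof -
  \<comment> \<open>With the common divisor \<open>N + 1\<close>, the average at \<open>x\<close> is a null sequence plus a lower bound for the
    average at \<open>T x\<close>; the null sequence is subtracted along a subsequence that attains the limes superior.\<close>
  define u where "u N = orbit_sum T f (N + 1) x / of_nat (N + 1)" for N
  define d where "d N = f x / of_nat (Suc N)" for N
  define w where "w N = orbit_sum T f N (T x) / of_nat (Suc N)" for N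
  have u: "u N = d N + w N" for N
    by (simp add: u_def d_def w_def orbit_sum_Suc add_divide_distrib_ennreal)
  have dfin: "d N < \<infinity>" for N
    using assms by (simp add: d_def ennreal_divide_eq_top_iff less_top[symmetric] del: of_nat_Suc)
  obtain r where r: "strict_mono r" "(u \<circ> r) \<longlonglongrightarrow> limsup u"
    using limsup_subseq_lim by blast
  have "(\<lambda>n. (u \<circ> r) n - (d \<circ> r) n) \<longlonglongrightarrow> limsup u - 0"
    using r(2)[unfolded comp_def]
      LIMSEQ_subseq_LIMSEQ[OF tendsto_divide_Suc_0_ennreal[OF assms] r(1), unfolded comp_def]
    unfolding comp_def d_def by (intro tendsto_diff_ennreal_general) auto
  then have "(w \<circ> r) \<longlonglongrightarrow> limsup u"
    using dfin by (simp add: u comp_def less_top[symmetric])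
  then have "limsup u = limsup (w \<circ> r)"
    by (simp add: lim_imp_Limsup)
  also have "\<dots> \<le> limsup w" by (rule limsup_subseq_mono[OF r(1)])
  also have "\<dots> \<le> limsup (\<lambda>N. orbit_sum T f N (T x) / of_nat N)"
  proof (intro Limsup_mono always_eventually allI)
    fix N show "w N \<le> orbit_sum T f N (T x) / of_nat N"
    proof (cases "N = 0")
      case False
      then have "inverse (of_nat (Suc N)) \<le> (inverse (of_nat N) :: ennreal)"
        unfolding ennreal_of_nat_eq_real_of_nat
        by (simp add: inverse_ennreal ennreal_leI le_imp_inverse_le del: of_nat_Suc)
      then show ?thesis unfolding w_def divide_ennreal_def by (intro mult_left_mono) auto
    qed (simp add: w_def orbit_sum_def)
  qed
  finally show ?thesis
    unfolding u_def limsup_shift[of "\<lambda>N. orbit_sum T f N x / of_nat N"] .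
qed

section \<open>The pointwise ergodic theorem for a monotone sequence\<close>

context measure_preserving_map
begin

text \<open>If the inequality fails, two rationals \<open>p < q\<close> separate its two sides. The points where they do
  so, and whose orbit meets only finite values of the limit function \<open>G\<close>, form a forward invariant
  set \<open>D\<close>. The maximal inequality gives \<open>q \<mu>(D) \<le> \<integral>\<^sub>D G\<close> from the upper averages, and
  \<open>\<integral>\<^sub>D g\<^sub>n \<le> p \<mu>(D)\<close> for each \<open>n\<close> from the lower ones, hence \<open>\<integral>\<^sub>D G \<le> p \<mu>(D)\<close> by monotone
  convergence. As \<open>\<mu>(D)\<close> is finite, it vanishes.\<close>

lemma AE_limsup_average_le_SUP_liminf_average:
  fixes g :: "nat \<Rightarrow> 'a \<Rightarrow> ennreal"
  assumes [measurable]: "\<And>n. g n \<in> borel_measurable M"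
    and inc: "incseq g"
  shows "AE x in M. limsup (\<lambda>N. orbit_sum T (\<lambda>y. SUP n. g n y) N x / of_nat N)
    \<le> (SUP n. liminf (\<lambda>N. orbit_sum T (g n) N x / of_nat N))"
proof -
  define G where "G x = (SUP n. g n x)" for x
  define u where "u x = limsup (\<lambda>N. orbit_sum T G N x / of_nat N)" for x
  define l where "l x = (SUP n. liminf (\<lambda>N. orbit_sum T (g n) N x / of_nat N))" for x
  have [measurable]: "G \<in> borel_measurable M" unfolding G_def[abs_def] by measurable
  have [measurable]: "u \<in> borel_measurable M" "l \<in> borel_measurable M"
    unfolding u_def[abs_def] l_def[abs_def] by measurable
  have l_T: "l (T x) \<le> l x" for x
    unfolding l_def by (intro SUP_mono') (rule liminf_average_shift_le)
  have int_G_le: "(\<integral>\<^sup>+x\<in>D. G x \<partial>M) \<le> p * emeasure M D"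
    if [measurable]: "D \<in> sets M" and inv: "\<And>x. x \<in> D \<Longrightarrow> T x \<in> D" and less: "\<And>x. x \<in> D \<Longrightarrow> l x < p" for D p
  proof -
    have "(\<integral>\<^sup>+x\<in>D. G x \<partial>M) = (\<integral>\<^sup>+x. (SUP n. g n x * indicator D x) \<partial>M)"
      by (simp add: G_def SUP_mult_right_ennreal)
    also have "\<dots> = (SUP n. \<integral>\<^sup>+x\<in>D. g n x \<partial>M)"
      using inc by (intro nn_integral_monotone_convergence_SUP)
        (auto simp: incseq_def le_fun_def intro!: mult_right_mono)
    also have "\<dots> \<le> p * emeasure M D"
    proof (intro SUP_least nn_integral_le_of_average_le inv)
      fix n x assume "x \<in> D"
      have "liminf (\<lambda>N. orbit_sum T (g n) N x / of_nat N) \<le> l x"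
        unfolding l_def by (rule SUP_upper) simp
      with less[OF \<open>x \<in> D\<close>] have "\<not> p \<le> liminf (\<lambda>N. orbit_sum T (g n) N x / of_nat N)" by auto
      then have "\<not> (\<forall>\<^sub>F N in sequentially. p \<le> orbit_sum T (g n) N x / of_nat N)"
        by (auto dest: Liminf_bounded)
      then obtain j where j: "j \<ge> 1" "orbit_sum T (g n) j x / of_nat j < p"
        unfolding eventually_sequentially by (auto simp: not_le)
      then have "orbit_sum T (g n) j x < p * of_nat j"
        by (subst (asm) divide_less_ennreal) (auto simp: of_nat_less_top)
      with j show "\<exists>j\<ge>1. orbit_sum T (g n) j x \<le> p * of_nat j" by auto
    qed auto
    finally show ?thesis .
  qed
  have null: "AE x in M. \<not> (l x < ennreal p \<and> ennreal p < ennreal q \<and> ennreal q < u x)" for p q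
  proof (cases "ennreal p < ennreal q")
    case True
    \<comment> \<open>Forward invariance of the upper averages needs finite values of \<open>G\<close> along the orbit. These hold
      almost everywhere on \<open>C\<close>, because \<open>C\<close> is itself forward invariant and so \<open>G\<close> is integrable on it.\<close>
    define C where "C = {x\<in>space M. l x < p}"
    have [measurable]: "C \<in> sets M" unfolding C_def by measurable
    have C_T: "T x \<in> C" if "x \<in> C" for x
      using that l_T[of x] measurable_space[OF T_measurable] by (auto simp: C_def)
    have "(\<integral>\<^sup>+x. G x * indicator C x \<partial>M) \<le> p * emeasure M C"
      by (rule int_G_le) (auto simp: C_T, auto simp: C_def)
    also have "\<dots> < \<infinity>"
      using emeasure_finite[of C] by (simp add: ennreal_mult_eq_top_iff less_top[symmetric])
    finally have "AE x in M. G x * indicator C x \<noteq> \<infinity>"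
      by (intro nn_integral_PInf_AE) auto
    then have "AE x in M. G ((T ^^ i) x) * indicator C ((T ^^ i) x) \<noteq> \<infinity>" for i
      by (subst (asm) distr_funpow[of i, symmetric]) (rule AE_distrD[OF funpow_measurable])
    then have fin: "AE x in M. \<forall>i. G ((T ^^ i) x) * indicator C ((T ^^ i) x) \<noteq> \<infinity>"
      by (simp add: AE_all_countable)
    define D where "D = {x\<in>C. q < u x \<and> (\<forall>i. G ((T ^^ i) x) < \<infinity>)}"
    have "D = C \<inter> {x\<in>space M. q < u x \<and> (\<forall>i. G ((T ^^ i) x) < \<infinity>)}"
      using sets.sets_into_space[OF \<open>C \<in> sets M\<close>] by (auto simp: D_def)
    then have [measurable]: "D \<in> sets M" by simp
    have D_T: "T x \<in> D" if "x \<in> D" for x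
    proof -
      have "G x < \<infinity>" using that unfolding D_def by (auto dest: spec[of _ 0])
      then have "u x \<le> u (T x)" unfolding u_def by (rule limsup_average_le_shift)
      moreover have "G ((T ^^ i) (T x)) < \<infinity>" for i
        using that unfolding D_def by (auto dest: spec[of _ "Suc i"] simp: funpow_swap1)
      ultimately show ?thesis using that C_T unfolding D_def by auto
    qed
    have "q * emeasure M D \<le> (\<integral>\<^sup>+x\<in>D. G x \<partial>M)"
    proof (rule nn_integral_ge_of_average_ge[OF _ _ D_T])
      fix x assume "x \<in> D"
      then have "\<not> u x \<le> q" by (auto simp: D_def)
      then have "\<not> (\<forall>\<^sub>F N in sequentially. orbit_sum T G N x / of_nat N \<le> q)"
        unfolding u_def by (auto dest: Limsup_bounded)
      then obtain j where j: "j \<ge> 1" "q < orbit_sum T G j x / of_nat j"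
        unfolding eventually_sequentially by (auto simp: not_le)
      then have "\<not> orbit_sum T G j x \<le> of_nat j * ennreal q"
        using divide_le_posI_ennreal[of "of_nat j" "orbit_sum T G j x" "ennreal q"]
        by (auto simp: not_le[symmetric])
      with j show "\<exists>j\<ge>1. ennreal q * of_nat j \<le> orbit_sum T G j x"
        by (auto simp: mult.commute not_le intro!: exI[of _ j])
    qed auto
    also have "\<dots> \<le> p * emeasure M D"
      by (rule int_G_le) (auto simp: D_T, auto simp: D_def C_def)
    finally have "\<not> 0 < emeasure M D"
      using ennreal_mult_strict_right_mono[OF True, of "emeasure M D"] emeasure_finite[of D]
      by (metis leD infinity_ennreal_def less_top)
    then have "AE x in M. x \<notin> D"
      by (intro AE_not_in) (auto simp: null_sets_def)
    with fin AE_space show ?thesis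
    proof eventually_elim
      case (elim x)
      show ?case
      proof
        assume x: "l x < ennreal p \<and> ennreal p < ennreal q \<and> ennreal q < u x"
        with elim have "x \<in> C" by (simp add: C_def)
        then have "(T ^^ i) x \<in> C" for i by (induction i) (auto simp: C_T)
        with elim have "G ((T ^^ i) x) < \<infinity>" for i by (auto simp: less_top)
        with x \<open>x \<in> C\<close> have "x \<in> D" by (simp add: D_def)
        with elim show False by simp
      qed
    qed
  qed simp
  have "AE x in M. \<forall>p q. \<not> (l x < ennreal (real_of_rat p) \<and>
      ennreal (real_of_rat p) < ennreal (real_of_rat q) \<and> ennreal (real_of_rat q) < u x)"
    unfolding AE_all_countable by (intro allI null)
  then have "AE x in M. u x \<le> l x"
  proof eventually_elim
    case (elim x)
    show ?case
    proof (rule ccontr)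
      assume "\<not> u x \<le> l x"
      then obtain p where p: "l x < ennreal (real_of_rat p)" "ennreal (real_of_rat p) < u x"
        using ennreal_rat_dense[of "l x" "u x"] by (auto simp: not_le)
      then obtain q where "ennreal (real_of_rat p) < ennreal (real_of_rat q)" "ennreal (real_of_rat q) < u x"
        using ennreal_rat_dense[OF p(2)] by auto
      with p elim show False by blast
    qed
  qed
  then show ?thesis by (simp add: u_def l_def G_def[abs_def])
qed

text \<open>For a constant sequence the preceding inequality is Birkhoff's theorem: the upper average is at
  most the lower one. For the sequence itself it bounds the upper average of the supremum
  by the supremum of the limits, which by monotonicity is also a lower bound for the lower average.\<close>

corollary AE_convergent_averages_SUP:
  fixes g :: "nat \<Rightarrow> 'a \<Rightarrow> ennreal"
  assumes meas [measurable]: "\<And>n. g n \<in> borel_measurable M"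
    and inc: "incseq g"
  shows "AE x in M. \<exists>l L. (\<forall>n. (\<lambda>N. orbit_sum T (g n) N x / of_nat N) \<longlonglongrightarrow> l n) \<and> l \<longlonglongrightarrow> L \<and>
    (\<lambda>N. orbit_sum T (\<lambda>y. SUP n. g n y) N x / of_nat N) \<longlonglongrightarrow> L"
proof -
  have "AE x in M. limsup (\<lambda>N. orbit_sum T (g n) N x / of_nat N)
      \<le> liminf (\<lambda>N. orbit_sum T (g n) N x / of_nat N)" for n
    using AE_limsup_average_le_SUP_liminf_average[of "\<lambda>_. g n"] by simp
  then have "AE x in M. \<forall>n. limsup (\<lambda>N. orbit_sum T (g n) N x / of_nat N)
      \<le> liminf (\<lambda>N. orbit_sum T (g n) N x / of_nat N)"
    by (simp add: AE_all_countable)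
  with AE_limsup_average_le_SUP_liminf_average[OF assms] show ?thesis
  proof eventually_elim
    case (elim x)
    let ?A = "\<lambda>f N. orbit_sum T f N x / of_nat N"
    define G where "G y = (SUP n. g n y)" for y
    define l where "l n = liminf (?A (g n))" for n
    have conv: "?A (g n) \<longlonglongrightarrow> l n" for n
      unfolding l_def using elim(2)[rule_format, of n]
      by (intro tendsto_Liminf antisym Liminf_le_Limsup) auto
    have "orbit_sum T (g m) N x \<le> orbit_sum T (g n) N x" if "m \<le> n" for m n N
      using inc that by (intro orbit_sum_mono) (auto simp: incseq_def le_fun_def)
    then have "incseq l"
      unfolding l_def by (auto simp: incseq_def intro!: Liminf_mono always_eventually divide_right_mono_ennreal)
    then have l: "l \<longlonglongrightarrow> (SUP n. l n)" by (rule LIMSEQ_SUP)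
    have "(SUP n. l n) \<le> liminf (?A G)"
      unfolding l_def G_def
      by (intro SUP_least Liminf_mono always_eventually allI divide_right_mono_ennreal orbit_sum_mono SUP_upper) auto
    moreover have "limsup (?A G) \<le> (SUP n. l n)"
      using elim(1) by (simp add: G_def[abs_def] l_def)
    moreover have "liminf (?A G) \<le> limsup (?A G)" by (intro Liminf_le_Limsup) simp
    ultimately have "?A G \<longlonglongrightarrow> (SUP n. l n)"
      by (intro Liminf_eq_Limsup) auto
    with conv l show ?case unfolding G_def[abs_def] by blast
  qed
qed

end

section \<open>Time averages on the real line\<close>

lemma nn_integral_symmetric_interval:
  fixes h :: "real \<Rightarrow> ennreal"
  assumes [measurable]: "h \<in> borel_measurable borel"
  shows "(\<integral>\<^sup>+t\<in>{-T..T}. h t \<partial>lborel)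
    = (\<integral>\<^sup>+t\<in>{0..<T}. h t \<partial>lborel) + (\<integral>\<^sup>+t\<in>{0..<T}. h (- t) \<partial>lborel)"
proof -
  have "(\<integral>\<^sup>+t\<in>{0..<T}. h (- t) \<partial>lborel) = (\<integral>\<^sup>+t\<in>{-T<..0}. h t \<partial>lborel)"
    by (subst nn_integral_real_affine[where c = "-1" and t = 0])
       (auto intro!: nn_integral_cong simp: indicator_def)
  then have "(\<integral>\<^sup>+t\<in>{0..<T}. h t \<partial>lborel) + (\<integral>\<^sup>+t\<in>{0..<T}. h (- t) \<partial>lborel)
      = (\<integral>\<^sup>+t. h t * indicator {0..<T} t + h t * indicator {-T<..0} t \<partial>lborel)"
    by (simp add: nn_integral_add)
  also have "\<dots> = (\<integral>\<^sup>+t\<in>{-T..T}. h t \<partial>lborel)"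
    using AE_lborel_singleton[of 0] AE_lborel_singleton[of T] AE_lborel_singleton[of "-T"]
    by (intro nn_integral_cong_AE, eventually_elim) (auto simp: indicator_def)
  finally show ?thesis by simp
qed

lemma nn_integral_sum_unit_intervals:
  fixes h :: "real \<Rightarrow> ennreal"
  assumes [measurable]: "h \<in> borel_measurable borel"
  shows "(\<Sum>k<N. \<integral>\<^sup>+t\<in>{0..<1}. h (t + real k) \<partial>lborel) = (\<integral>\<^sup>+t\<in>{0..<real N}. h t \<partial>lborel)"
proof (induction N)
  case (Suc N)
  have "(\<integral>\<^sup>+t\<in>{0..<1}. h (t + real N) \<partial>lborel) = (\<integral>\<^sup>+t\<in>{real N..<real (Suc N)}. h t \<partial>lborel)"
    by (subst (2) nn_integral_real_affine[where c = 1 and t = "real N"])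
       (auto intro!: nn_integral_cong simp: indicator_def add.commute)
  then have "(\<Sum>k<Suc N. \<integral>\<^sup>+t\<in>{0..<1}. h (t + real k) \<partial>lborel)
      = (\<integral>\<^sup>+t. h t * indicator {0..<real N} t + h t * indicator {real N..<real (Suc N)} t \<partial>lborel)"
    using Suc by (simp add: nn_integral_add)
  also have "\<dots> = (\<integral>\<^sup>+t\<in>{0..<real (Suc N)}. h t \<partial>lborel)"
    by (intro nn_integral_cong) (auto simp: indicator_def)
  finally show ?case .
qed simp

text \<open>By monotonicity, the mean up to \<open>T\<close> lies between the means up to the two neighbouring integers,
  multiplied by factors \<open>\<lfloor>T\<rfloor> / T\<close> and \<open>(\<lfloor>T\<rfloor> + 1) / T\<close> that tend to 1. A limit \<open>\<infinity>\<close> is harmless, as no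
  differences occur.\<close>

lemma tendsto_mean_of_tendsto_nat_mean:
  fixes I :: "real \<Rightarrow> ennreal"
  assumes mono: "mono I"
    and lim: "(\<lambda>N. I (real N) / ennreal (2 * real N)) \<longlonglongrightarrow> L"
  shows "((\<lambda>T. I T / ennreal (2 * T)) \<longlongrightarrow> L) at_top"
proof -
  define A where "A N = I (real N) / ennreal (2 * real N)" for N
  define N where "N T = nat \<lfloor>T\<rfloor>" for T :: real
  have scale: "I (real n) / ennreal (2 * T) = A n * ennreal (real n / T)" if "n > 0" "T > 0" for n T
  proof -
    have "ennreal (real n / T) / ennreal (2 * real n) = ennreal (inverse (2 * T))"
      using that by (subst divide_ennreal) (auto simp: field_simps)
    also have "\<dots> = inverse (ennreal (2 * T))"
      using that by (subst inverse_ennreal) auto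
    finally show ?thesis by (simp add: A_def divide_ennreal_def mult_ac)
  qed
  have A: "A \<longlonglongrightarrow> L" using lim by (simp add: A_def[abs_def])
  have N_top: "filterlim N sequentially at_top"
    unfolding N_def by (intro filterlim_compose[OF filterlim_nat_sequentially] filterlim_floor_sequentially)
  have one: "((\<lambda>T. ennreal (real (N T + k) / T)) \<longlongrightarrow> 1) at_top" for k
  proof -
    have "((\<lambda>T. (real_of_int \<lfloor>T\<rfloor> + real k) / T) \<longlongrightarrow> 1) at_top" by real_asymp
    then have "((\<lambda>T. real (N T + k) / T) \<longlongrightarrow> 1) at_top"
      by (rule Lim_transform_eventually)
         (auto simp: N_def intro!: eventually_mono[OF eventually_ge_at_top[of 0]])
    then have "((\<lambda>T. ennreal (real (N T + k) / T)) \<longlongrightarrow> ennreal 1) at_top" by (rule tendsto_ennrealI)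
    then show ?thesis by simp
  qed
  have N_k: "((\<lambda>T. A (N T + k) * ennreal (real (N T + k) / T)) \<longlongrightarrow> L) at_top" for k
  proof -
    have "((\<lambda>T. A (N T + k)) \<longlongrightarrow> L) at_top"
      using filterlim_compose[OF LIMSEQ_ignore_initial_segment[OF A, of k] N_top] .
    then have "((\<lambda>T. A (N T + k) * ennreal (real (N T + k) / T)) \<longlongrightarrow> L * 1) at_top"
      using one[of k] by (intro tendsto_mult_ennreal) auto
    then show ?thesis by simp
  qed
  show ?thesis
  proof (rule tendsto_sandwich[OF _ _ N_k[of 0] N_k[of 1]])
    show "\<forall>\<^sub>F T in at_top. A (N T + 0) * ennreal (real (N T + 0) / T) \<le> I T / ennreal (2 * T)"
      using eventually_ge_at_top[of 1]
    proof eventually_elim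
      case (elim T)
      then have "N T > 0" "real (N T) \<le> T" by (auto simp: N_def)
      then show ?case using elim scale[of "N T" T] monoD[OF mono, of "real (N T)" T]
        by (simp add: divide_right_mono_ennreal flip: scale)
    qed
    show "\<forall>\<^sub>F T in at_top. I T / ennreal (2 * T) \<le> A (N T + 1) * ennreal (real (N T + 1) / T)"
      using eventually_ge_at_top[of 1]
    proof eventually_elim
      case (elim T)
      then have "T \<le> real (N T + 1)" unfolding N_def by linarith
      then show ?case using elim scale[of "N T + 1" T] monoD[OF mono, of T "real (N T + 1)"]
        by (metis add_gr_0 divide_right_mono_ennreal less_le_trans less_numeral_extra(1))
    qed
  qed
qed

section \<open>Measure preserving flows\<close>

lemma (in complete_measure) measurable_cong_AE_complete:
  assumes f: "f \<in> M \<rightarrow>\<^sub>M N" and eq: "AE x in M. g x = f x"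
    and g: "g \<in> space M \<rightarrow> space N"
  shows "g \<in> M \<rightarrow>\<^sub>M N"
proof (rule measurableI)
  fix A assume "A \<in> sets N"
  then have "f -` A \<inter> space M \<in> sets M" using f by (rule measurable_sets[rotated])
  moreover have "AE x in M. x \<in> f -` A \<inter> space M \<longleftrightarrow> x \<in> g -` A \<inter> space M"
    using eq by eventually_elim auto
  ultimately show "g -` A \<inter> space M \<in> sets M"
    by (intro in_sets_AE[of "f -` A \<inter> space M" "g -` A \<inter> space M"]) auto
qed (use g in auto)

locale measure_preserving_flow = finite_measure M for M :: "'a measure" +
  fixes \<phi> :: "real \<Rightarrow> 'a \<Rightarrow> 'a"
  assumes flow_measurable: "(\<lambda>(t, x). \<phi> t x) \<in> borel \<Otimes>\<^sub>M M \<rightarrow>\<^sub>M M"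
    and flow_add: "\<And>s t x. x \<in> space M \<Longrightarrow> \<phi> (s + t) x = \<phi> s (\<phi> t x)"
    and flow_0: "\<And>x. x \<in> space M \<Longrightarrow> \<phi> 0 x = x"
    and distr_flow: "\<And>t. distr M M (\<phi> t) = M"
begin

lemma flow_measurable_compose [measurable (raw)]:
  assumes "f \<in> N \<rightarrow>\<^sub>M borel" "g \<in> N \<rightarrow>\<^sub>M M"
  shows "(\<lambda>y. \<phi> (f y) (g y)) \<in> N \<rightarrow>\<^sub>M M"
  using measurable_compose[OF measurable_Pair[OF assms] flow_measurable] by simp

lemma flow_at_measurable: "\<phi> t \<in> M \<rightarrow>\<^sub>M M"
  by (rule flow_measurable_compose) auto

lemma flow_space: "x \<in> space M \<Longrightarrow> \<phi> t x \<in> space M"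
  by (rule measurable_space[OF flow_at_measurable])

lemma flow_orbit_measurable: "x \<in> space M \<Longrightarrow> f \<in> borel_measurable M \<Longrightarrow> (\<lambda>t. f (\<phi> t x)) \<in> borel_measurable borel"
  by (rule measurable_compose[OF flow_measurable_compose]) auto

lemma reverse_flow: "measure_preserving_flow M (\<lambda>t. \<phi> (- t))"
proof
  show "(\<lambda>(t, x). \<phi> (- t) x) \<in> borel \<Otimes>\<^sub>M M \<rightarrow>\<^sub>M M" by measurable
  show "\<phi> (- (s + t)) x = \<phi> (- s) (\<phi> (- t) x)" if "x \<in> space M" for s t x
    using flow_add[OF that, of "-s" "-t"] by simp
qed (simp_all add: flow_0 distr_flow)

sublocale time_one: measure_preserving_map M "\<phi> 1"
  by unfold_locales (simp_all add: flow_at_measurable distr_flow)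

lemma time_one_funpow: "x \<in> space M \<Longrightarrow> (\<phi> 1 ^^ k) x = \<phi> (real k) x"
proof (induction k)
  case (Suc k)
  then show ?case using flow_add[of x 1 "real k"] by (simp add: add.commute)
qed (simp add: flow_0)

lemma orbit_sum_time_one:
  assumes x: "x \<in> space M" and f: "f \<in> borel_measurable M"
  shows "orbit_sum (\<phi> 1) (\<lambda>y. \<integral>\<^sup>+t\<in>{0..<1}. f (\<phi> t y) \<partial>lborel) N x
    = (\<integral>\<^sup>+t\<in>{0..<real N}. f (\<phi> t x) \<partial>lborel)"
  using nn_integral_sum_unit_intervals[OF flow_orbit_measurable[OF x f], of N]
  by (simp add: orbit_sum_def time_one_funpow x flip: flow_add)

text \<open>Sampling the flow at integer times: the integral over \<open>[0, N)\<close> is the orbit sum, under the time-one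
  map, of the integral over the first unit of time. By monotone convergence the latter respects the
  supremum, so the theorem for a single map applies.\<close>

lemma AE_convergent_forward_means_SUP:
  fixes f :: "nat \<Rightarrow> 'a \<Rightarrow> ennreal"
  assumes f [measurable]: "\<And>n. f n \<in> borel_measurable M" and inc: "incseq f"
  shows "AE x in M. \<exists>l L.
    (\<forall>n. (\<lambda>N. (\<integral>\<^sup>+t\<in>{0..<real N}. f n (\<phi> t x) \<partial>lborel) / of_nat N) \<longlonglongrightarrow> l n) \<and> l \<longlonglongrightarrow> L \<and>
    (\<lambda>N. (\<integral>\<^sup>+t\<in>{0..<real N}. (SUP n. f n (\<phi> t x)) \<partial>lborel) / of_nat N) \<longlonglongrightarrow> L"
proof -
  define g where "g n x = (\<integral>\<^sup>+t\<in>{0..<1}. f n (\<phi> t x) \<partial>lborel)" for n x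
  have "AE x in M. \<exists>l L. (\<forall>n. (\<lambda>N. orbit_sum (\<phi> 1) (g n) N x / of_nat N) \<longlonglongrightarrow> l n) \<and> l \<longlonglongrightarrow> L \<and>
    (\<lambda>N. orbit_sum (\<phi> 1) (\<lambda>y. SUP n. g n y) N x / of_nat N) \<longlonglongrightarrow> L"
  proof (rule time_one.AE_convergent_averages_SUP)
    show "g n \<in> borel_measurable M" for n
      unfolding g_def[abs_def] by measurable
    show "incseq g"
      using inc unfolding incseq_def le_fun_def g_def
      by (auto intro!: nn_integral_mono mult_right_mono)
  qed
  with AE_space show ?thesis
  proof eventually_elim
    case (elim x)
    have "(SUP n. g n y) = (\<integral>\<^sup>+t\<in>{0..<1}. (SUP n. f n (\<phi> t y)) \<partial>lborel)" if y: "y \<in> space M" for y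
    proof -
      have "(\<integral>\<^sup>+t\<in>{0..<1}. (SUP n. f n (\<phi> t y)) \<partial>lborel)
          = (\<integral>\<^sup>+t. (SUP n. f n (\<phi> t y) * indicator {0..<1} t) \<partial>lborel)"
        by (simp add: SUP_mult_right_ennreal)
      also have "\<dots> = (SUP n. g n y)"
        unfolding g_def using inc flow_orbit_measurable[OF y f]
        by (intro nn_integral_monotone_convergence_SUP)
           (auto simp: incseq_def le_fun_def intro!: mult_right_mono)
      finally show ?thesis by simp
    qed
    then have "orbit_sum (\<phi> 1) (\<lambda>y. SUP n. g n y) N x
        = orbit_sum (\<phi> 1) (\<lambda>y. \<integral>\<^sup>+t\<in>{0..<1}. (SUP n. f n (\<phi> t y)) \<partial>lborel) N x" for N
      unfolding orbit_sum_def using elim(1) by (intro sum.cong) (auto simp: time_one.funpow_space)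
    then have "orbit_sum (\<phi> 1) (\<lambda>y. SUP n. g n y) N x
        = (\<integral>\<^sup>+t\<in>{0..<real N}. (SUP n. f n (\<phi> t x)) \<partial>lborel)" for N
      using orbit_sum_time_one[OF elim(1), of "\<lambda>y. SUP n. f n y" N] by simp
    moreover have "orbit_sum (\<phi> 1) (g n) N x = (\<integral>\<^sup>+t\<in>{0..<real N}. f n (\<phi> t x) \<partial>lborel)" for n N
      using orbit_sum_time_one[OF elim(1) f, of n N] by (simp add: g_def[abs_def])
    ultimately show ?case using elim(2) by simp
  qed
qed

text \<open>The mean over \<open>[-T, T]\<close> is the average of the one-sided means of the flow and of the reversed flow.
  Both converge almost everywhere by the one-sided theorem.\<close>

lemma tendsto_two_sided_mean:
  fixes f :: "'a \<Rightarrow> ennreal"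
  assumes x: "x \<in> space M" and f: "f \<in> borel_measurable M"
    and fwd: "(\<lambda>N. (\<integral>\<^sup>+t\<in>{0..<real N}. f (\<phi> t x) \<partial>lborel) / of_nat N) \<longlonglongrightarrow> a"
    and bwd: "(\<lambda>N. (\<integral>\<^sup>+t\<in>{0..<real N}. f (\<phi> (- t) x) \<partial>lborel) / of_nat N) \<longlonglongrightarrow> b"
  shows "((\<lambda>T. (\<integral>\<^sup>+t\<in>{-T..T}. f (\<phi> t x) \<partial>lborel) / ennreal (2 * T)) \<longlongrightarrow> (a + b) / 2) at_top"
proof (rule tendsto_mean_of_tendsto_nat_mean)
  show "mono (\<lambda>T. \<integral>\<^sup>+t\<in>{-T..T}. f (\<phi> t x) \<partial>lborel)"
    by (intro monoI nn_integral_mono mult_left_mono) (auto simp: indicator_def)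
  have "(\<integral>\<^sup>+t\<in>{-real N..real N}. f (\<phi> t x) \<partial>lborel) / ennreal (2 * real N)
      = ((\<integral>\<^sup>+t\<in>{0..<real N}. f (\<phi> t x) \<partial>lborel) / of_nat N
        + (\<integral>\<^sup>+t\<in>{0..<real N}. f (\<phi> (- t) x) \<partial>lborel) / of_nat N) * inverse 2" if "N > 0" for N
  proof -
    have "inverse (ennreal (2 * real N)) = inverse (of_nat N) * inverse 2"
      using that by (simp add: ennreal_mult ennreal_inverse_mult ennreal_of_nat_eq_real_of_nat mult.commute)
    then show ?thesis
      unfolding nn_integral_symmetric_interval[OF flow_orbit_measurable[OF x f]]
      by (simp add: divide_ennreal_def distrib_right mult.assoc)
  qed
  then have "\<forall>\<^sub>F N in sequentially. ((\<integral>\<^sup>+t\<in>{0..<real N}. f (\<phi> t x) \<partial>lborel) / of_nat N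
        + (\<integral>\<^sup>+t\<in>{0..<real N}. f (\<phi> (- t) x) \<partial>lborel) / of_nat N) * inverse 2
      = (\<integral>\<^sup>+t\<in>{-real N..real N}. f (\<phi> t x) \<partial>lborel) / ennreal (2 * real N)"
    by (auto intro!: eventually_mono[OF eventually_gt_at_top[of 0]])
  moreover have "(\<lambda>N. ((\<integral>\<^sup>+t\<in>{0..<real N}. f (\<phi> t x) \<partial>lborel) / of_nat N
        + (\<integral>\<^sup>+t\<in>{0..<real N}. f (\<phi> (- t) x) \<partial>lborel) / of_nat N) * inverse 2) \<longlonglongrightarrow> (a + b) / 2"
    unfolding divide_ennreal_def[of "a + b"]
    by (intro tendsto_mult_ennreal tendsto_add fwd bwd tendsto_const) auto
  ultimately show "(\<lambda>N. (\<integral>\<^sup>+t\<in>{-real N..real N}. f (\<phi> t x) \<partial>lborel) / ennreal (2 * real N)) \<longlonglongrightarrow> (a + b) / 2"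
    by (rule Lim_transform_eventually[rotated])
qed

lemma AE_convergent_means_SUP:
  fixes f :: "nat \<Rightarrow> 'a \<Rightarrow> ennreal"
  assumes f [measurable]: "\<And>n. f n \<in> borel_measurable M" and inc: "incseq f"
  shows "AE x in M. \<exists>l L.
    (\<forall>n. ((\<lambda>T. (\<integral>\<^sup>+t\<in>{-T..T}. f n (\<phi> t x) \<partial>lborel) / ennreal (2 * T)) \<longlongrightarrow> l n) at_top) \<and> l \<longlonglongrightarrow> L \<and>
    ((\<lambda>T. (\<integral>\<^sup>+t\<in>{-T..T}. (SUP n. f n (\<phi> t x)) \<partial>lborel) / ennreal (2 * T)) \<longlongrightarrow> L) at_top"
proof -
  interpret rev: measure_preserving_flow M "\<lambda>t. \<phi> (- t)" by (rule reverse_flow)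
  from AE_space AE_convergent_forward_means_SUP[OF assms] rev.AE_convergent_forward_means_SUP[OF assms]
  show ?thesis
  proof eventually_elim
    case (elim x)
    from elim(2) obtain a A where a:
      "\<And>n. (\<lambda>N. (\<integral>\<^sup>+t\<in>{0..<real N}. f n (\<phi> t x) \<partial>lborel) / of_nat N) \<longlonglongrightarrow> a n" "a \<longlonglongrightarrow> A"
      "(\<lambda>N. (\<integral>\<^sup>+t\<in>{0..<real N}. (SUP n. f n (\<phi> t x)) \<partial>lborel) / of_nat N) \<longlonglongrightarrow> A" by blast
    from elim(3) obtain b B where b:
      "\<And>n. (\<lambda>N. (\<integral>\<^sup>+t\<in>{0..<real N}. f n (\<phi> (- t) x) \<partial>lborel) / of_nat N) \<longlonglongrightarrow> b n" "b \<longlonglongrightarrow> B"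
      "(\<lambda>N. (\<integral>\<^sup>+t\<in>{0..<real N}. (SUP n. f n (\<phi> (- t) x)) \<partial>lborel) / of_nat N) \<longlonglongrightarrow> B" by blast
    have "(\<lambda>n. (a n + b n) / 2) \<longlonglongrightarrow> (A + B) / 2"
      unfolding divide_ennreal_def
      by (intro tendsto_mult_ennreal tendsto_add a b tendsto_const) auto
    moreover have "((\<lambda>T. (\<integral>\<^sup>+t\<in>{-T..T}. f n (\<phi> t x) \<partial>lborel) / ennreal (2 * T)) \<longlongrightarrow> (a n + b n) / 2) at_top" for n
      by (rule tendsto_two_sided_mean[OF elim(1) f a(1) b(1)])
    moreover have "((\<lambda>T. (\<integral>\<^sup>+t\<in>{-T..T}. (SUP n. f n (\<phi> t x)) \<partial>lborel) / ennreal (2 * T)) \<longlongrightarrow> (A + B) / 2) at_top"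
      by (rule tendsto_two_sided_mean[where f = "\<lambda>y. SUP n. f n y", OF elim(1) _ a(3) b(3)]) measurable
    ultimately show ?case
      by (intro exI[of _ "\<lambda>n. (a n + b n) / 2"] exI[of _ "(A + B) / 2"]) blast
  qed
qed

text \<open>Each time \<open>t\<close> is bad only for a null set of points, by invariance of the measure; Fubini exchanges
  the two quantifiers. Hence changing a function on a null set of the space is invisible along almost
  every orbit.\<close>

lemma AE_orbit_avoids_null_set:
  assumes N: "N \<in> null_sets M"
  shows "AE x in M. AE t in lborel. \<phi> t x \<notin> N"
proof -
  have [measurable]: "N \<in> sets M" using N by auto
  interpret pair: pair_sigma_finite lborel M by unfold_locales
  have "AE x in M. \<phi> t x \<notin> N" for t
  proof (rule AE_distrD[OF flow_at_measurable])
    show "AE x in distr M M (\<phi> t). x \<notin> N"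
      unfolding distr_flow by (rule AE_not_in[OF N])
  qed
  then have "AE t in lborel. AE x in M. \<phi> t x \<notin> N" by simp
  then show ?thesis
    by (subst (asm) pair.AE_commute) measurable
qed

lemma orbit_of_modification:
  fixes f F :: "'a \<Rightarrow> ennreal"
  assumes x: "x \<in> space M" and f: "f \<in> borel_measurable M"
    and avoid: "AE t in lborel. \<phi> t x \<notin> N"
    and eq: "\<And>y. y \<in> space M - N \<Longrightarrow> F y = f y"
  shows "(\<lambda>t. F (\<phi> t x)) \<in> borel_measurable lebesgue"
    and "(\<integral>\<^sup>+t\<in>{-T..T}. F (\<phi> t x) \<partial>lebesgue) = (\<integral>\<^sup>+t\<in>{-T..T}. f (\<phi> t x) \<partial>lborel)"
proof -
  have AE_eq: "AE t in lborel. F (\<phi> t x) = f (\<phi> t x)"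
    using avoid by eventually_elim (use flow_space[OF x] eq in auto)
  have "(\<lambda>t. f (\<phi> t x)) \<in> borel_measurable lebesgue"
    using flow_orbit_measurable[OF x f] by (simp add: measurable_completion)
  then show "(\<lambda>t. F (\<phi> t x)) \<in> borel_measurable lebesgue"
    using AE_completion[OF AE_eq]
    by (rule completion.measurable_cong_AE_complete) (auto elim: eventually_mono)
  show "(\<integral>\<^sup>+t\<in>{-T..T}. F (\<phi> t x) \<partial>lebesgue) = (\<integral>\<^sup>+t\<in>{-T..T}. f (\<phi> t x) \<partial>lborel)"
    unfolding nn_integral_completion
    using AE_eq by (intro nn_integral_cong_AE, eventually_elim) simp
qed

text \<open>The composition of a function measurable for the completion with the flow is in general not
  measurable for the product sigma-algebra of time and space, which Fubini needs. Therefore all \<open>F n\<close>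
  are first replaced by \<open>M\<close>-measurable functions: they are set to zero on one common null set outside which they agree with
  \<open>M\<close>-measurable versions. This keeps the sequence monotone everywhere, and almost every orbit meets
  the null set only during a null set of times.\<close>

theorem AE_convergent_means_completion:
  fixes F :: "nat \<Rightarrow> 'a \<Rightarrow> ennreal"
  assumes F: "\<And>n. F n \<in> borel_measurable (completion M)"
    and inc: "\<And>x. x \<in> space M \<Longrightarrow> incseq (\<lambda>n. F n x)"
    and lim: "\<And>x. x \<in> space M \<Longrightarrow> (\<lambda>n. F n x) \<longlonglongrightarrow> F_lim x"
  shows "AE x in completion M.
    (\<forall>n. (\<lambda>t. F n (\<phi> t x)) \<in> borel_measurable lebesgue) \<and>
    (\<lambda>t. F_lim (\<phi> t x)) \<in> borel_measurable lebesgue \<and>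
    (\<exists>l L.
      (\<forall>n. ((\<lambda>T. (\<integral>\<^sup>+t\<in>{-T..T}. F n (\<phi> t x) \<partial>lebesgue) / ennreal (2 * T)) \<longlongrightarrow> l n) at_top) \<and> l \<longlonglongrightarrow> L \<and>
      ((\<lambda>T. (\<integral>\<^sup>+t\<in>{-T..T}. F_lim (\<phi> t x) \<partial>lebesgue) / ennreal (2 * T)) \<longlongrightarrow> L) at_top)"
proof -
  from completion_ex_borel_measurable[OF F] obtain F' where
    F' [measurable]: "\<And>n. F' n \<in> borel_measurable M" and "\<And>n. AE x in M. F n x = F' n x"
    by metis
  then have "AE x in M. \<forall>n. F n x = F' n x" by (simp add: AE_all_countable)
  then obtain N where N: "N \<in> null_sets M" "\<And>x n. x \<in> space M - N \<Longrightarrow> F n x = F' n x"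
    by (auto elim!: AE_E simp: null_sets_def)
  have [measurable]: "N \<in> sets M" using N by auto
  define f where "f n x = F n x * indicator (space M - N) x" for n x
  have f [measurable]: "f n \<in> borel_measurable M" for n
  proof -
    have "f n x = F' n x * indicator (space M - N) x" for x
      using N(2)[of x n] by (auto simp: f_def indicator_def)
    then have "f n = (\<lambda>x. F' n x * indicator (space M - N) x)" by auto
    then show ?thesis by simp
  qed
  have inc_f: "incseq f"
    using inc by (auto simp: incseq_def le_fun_def f_def indicator_def)
  have F_f: "F n x = f n x" if "x \<in> space M - N" for n x using that by (simp add: f_def)
  have F_lim_f: "F_lim x = (SUP n. f n x)" if x: "x \<in> space M - N" for x
  proof -
    have "(\<lambda>n. F n x) \<longlonglongrightarrow> (SUP n. F n x)" using x by (intro LIMSEQ_SUP inc) auto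
    then show ?thesis using lim[of x] x F_f[OF x] by (auto intro: LIMSEQ_unique)
  qed
  have sup_f: "(\<lambda>x. SUP n. f n x) \<in> borel_measurable M" by measurable
  show ?thesis
    unfolding AE_completion_iff
    using AE_space AE_convergent_means_SUP[OF f inc_f] AE_orbit_avoids_null_set[OF N(1)]
  proof eventually_elim
    case (elim x)
    have "(\<lambda>t. F n (\<phi> t x)) \<in> borel_measurable lebesgue"
      "\<And>T. (\<integral>\<^sup>+t\<in>{-T..T}. F n (\<phi> t x) \<partial>lebesgue) = (\<integral>\<^sup>+t\<in>{-T..T}. f n (\<phi> t x) \<partial>lborel)" for n
      using orbit_of_modification[where F = "F n", OF elim(1) f elim(3)] F_f by blast+
    moreover have "(\<lambda>t. F_lim (\<phi> t x)) \<in> borel_measurable lebesgue"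
      "\<And>T. (\<integral>\<^sup>+t\<in>{-T..T}. F_lim (\<phi> t x) \<partial>lebesgue)
        = (\<integral>\<^sup>+t\<in>{-T..T}. (SUP n. f n (\<phi> t x)) \<partial>lborel)"
      using orbit_of_modification[where F = F_lim, OF elim(1) sup_f elim(3)] F_lim_f by blast+
    ultimately show ?case
      using elim(2) by simp
  qed
qed

end

section \<open>The Kronecker flow preserves the Haar measure\<close>

lemma nn_integral_periodic_shift:
  fixes h :: "real \<Rightarrow> ennreal"
  assumes [measurable]: "h \<in> borel_measurable borel"
    and per: "\<And>x. h (x + p) = h x" and a: "0 \<le> a" "a \<le> p"
  shows "(\<integral>\<^sup>+x\<in>{0..<p}. h (x + a) \<partial>lborel) = (\<integral>\<^sup>+x\<in>{0..<p}. h x \<partial>lborel)"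
proof -
  have "(\<integral>\<^sup>+x\<in>{0..<p}. h (x + a) \<partial>lborel) = (\<integral>\<^sup>+x\<in>{a..<p + a}. h x \<partial>lborel)"
    by (subst (2) nn_integral_real_affine[where c = 1 and t = a])
       (auto intro!: nn_integral_cong simp: indicator_def add.commute)
  also have "\<dots> = (\<integral>\<^sup>+x. h x * indicator {a..<p} x + h x * indicator {p..<p + a} x \<partial>lborel)"
    using a by (intro nn_integral_cong) (auto simp: indicator_def)
  also have "\<dots> = (\<integral>\<^sup>+x\<in>{a..<p}. h x \<partial>lborel) + (\<integral>\<^sup>+x\<in>{p..<p + a}. h x \<partial>lborel)"
    by (simp add: nn_integral_add)
  also have "(\<integral>\<^sup>+x\<in>{p..<p + a}. h x \<partial>lborel) = (\<integral>\<^sup>+x\<in>{0..<a}. h x \<partial>lborel)"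
    by (subst nn_integral_real_affine[where c = 1 and t = p])
       (auto intro!: nn_integral_cong simp: indicator_def add.commute per)
  also have "(\<integral>\<^sup>+x\<in>{a..<p}. h x \<partial>lborel) + (\<integral>\<^sup>+x\<in>{0..<a}. h x \<partial>lborel)
      = (\<integral>\<^sup>+x. h x * indicator {a..<p} x + h x * indicator {0..<a} x \<partial>lborel)"
    by (simp add: nn_integral_add)
  also have "\<dots> = (\<integral>\<^sup>+x\<in>{0..<p}. h x \<partial>lborel)"
    using a by (intro nn_integral_cong) (auto simp: indicator_def)
  finally show ?thesis .
qed

lemma sets_circle_measure [measurable_cong]: "sets circle_measure = sets (restrict_space borel (sphere 0 1))"
  by (simp add: circle_measure_def)

lemma cis_measurable: "cis \<in> borel \<rightarrow>\<^sub>M circle_measure"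
proof -
  have "cis \<in> borel \<rightarrow>\<^sub>M restrict_space borel (sphere 0 1)"
    by (intro measurable_restrict_space2 borel_measurable_continuous_onI continuous_intros) auto
  then show ?thesis by (simp add: measurable_cong_sets[OF refl sets_circle_measure])
qed

lemma nn_integral_circle_measure:
  fixes f :: "complex \<Rightarrow> ennreal"
  assumes [measurable]: "f \<in> borel_measurable circle_measure"
  shows "(\<integral>\<^sup>+z. f z \<partial>circle_measure) = (\<integral>\<^sup>+x\<in>{0..<2 * pi}. f (cis x) \<partial>lborel) / ennreal (2 * pi)"
proof -
  have f: "f \<in> borel_measurable (restrict_space borel (sphere 0 1))"
    using assms by (simp add: measurable_cong_sets[OF sets_circle_measure refl])
  have [measurable]: "(\<lambda>x. f (cis x)) \<in> borel_measurable borel"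
    by (rule measurable_compose[OF cis_measurable assms])
  have cis: "cis \<in> uniform_measure lborel {0..2 * pi} \<rightarrow>\<^sub>M restrict_space borel (sphere 0 1)"
    using cis_measurable by (simp add: measurable_cong_sets[OF _ sets_circle_measure] cong: measurable_cong_sets)
  have "(\<integral>\<^sup>+z. f z \<partial>circle_measure) = (\<integral>\<^sup>+x. f (cis x) \<partial>uniform_measure lborel {0..2 * pi})"
    unfolding circle_measure_def by (rule nn_integral_distr[OF cis]) (simp add: f)
  also have "\<dots> = (\<integral>\<^sup>+x. f (cis x) * indicator {0..2 * pi} x \<partial>lborel) / emeasure lborel {0..2 * pi}"
    by (subst nn_integral_uniform_measure) auto
  also have "(\<integral>\<^sup>+x. f (cis x) * indicator {0..2 * pi} x \<partial>lborel) = (\<integral>\<^sup>+x\<in>{0..<2 * pi}. f (cis x) \<partial>lborel)"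
    using AE_lborel_singleton[of "2 * pi"]
    by (intro nn_integral_cong_AE, eventually_elim) (auto simp: indicator_def)
  finally show ?thesis by simp
qed

lemma rotation_measurable:
  assumes "norm w = 1"
  shows "(\<lambda>z. z * w) \<in> circle_measure \<rightarrow>\<^sub>M circle_measure"
proof -
  have "(\<lambda>z. z * w) \<in> restrict_space borel (sphere 0 1) \<rightarrow>\<^sub>M restrict_space borel (sphere 0 1)"
    using assms by (intro measurable_restrict_space2 measurable_restrict_space1)
      (auto simp: space_restrict_space norm_mult)
  then show ?thesis by (simp cong: measurable_cong_sets add: sets_circle_measure)
qed

text \<open>In the arclength parametrization a rotation is a translation of the angle, and the integral of a
  \<open>2\<pi>\<close>-periodic function over one period does not depend on the starting point.\<close>

lemma distr_rotation_circle_measure: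
  assumes w: "norm w = 1"
  shows "distr circle_measure circle_measure (\<lambda>z. z * w) = circle_measure"
proof (rule measure_eqI)
  fix A assume "A \<in> sets (distr circle_measure circle_measure (\<lambda>z. z * w))"
  then have A [measurable]: "A \<in> sets circle_measure" by simp
  note [measurable] = rotation_measurable[OF w]
  define \<theta> where "\<theta> = Arg2pi w"
  have \<theta>: "w = cis \<theta>" "0 \<le> \<theta>" "\<theta> \<le> 2 * pi"
    using Arg2pi[of w] w by (auto simp: \<theta>_def cis_conv_exp is_Arg_def)
  have [measurable]: "(\<lambda>x. indicator A (cis x) :: ennreal) \<in> borel_measurable borel"
    by (rule measurable_compose[OF cis_measurable]) simp
  have rotated: "(\<lambda>z. indicator A (z * w) :: ennreal) \<in> borel_measurable circle_measure"
    by measurable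
  have "emeasure (distr circle_measure circle_measure (\<lambda>z. z * w)) A
      = (\<integral>\<^sup>+z. indicator A z \<partial>distr circle_measure circle_measure (\<lambda>z. z * w))"
    by simp
  also have "\<dots> = (\<integral>\<^sup>+z. indicator A (z * w) \<partial>circle_measure)"
    by (rule nn_integral_distr) simp_all
  also have "\<dots> = (\<integral>\<^sup>+x\<in>{0..<2 * pi}. indicator A (cis (x + \<theta>)) \<partial>lborel) / ennreal (2 * pi)"
    by (subst nn_integral_circle_measure[OF rotated]) (simp add: \<theta>(1) cis_mult)
  also have "\<dots> = (\<integral>\<^sup>+x\<in>{0..<2 * pi}. indicator A (cis x) \<partial>lborel) / ennreal (2 * pi)"
    by (subst nn_integral_periodic_shift) (simp_all add: \<theta> flip: cis_mult)
  also have "\<dots> = emeasure circle_measure A"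
    by (subst nn_integral_circle_measure[symmetric]) simp_all
  finally show "emeasure (distr circle_measure circle_measure (\<lambda>z. z * w)) A = emeasure circle_measure A" .
qed simp

text \<open>A product measure is determined by its values on finite-dimensional boxes. The preimage of a box
  under multiplication by \<^term>\<open>w\<close> is the box of the rotated sides, so the claim reduces to rotation
  invariance in each coordinate.\<close>

lemma distr_torus_mult:
  assumes w: "w \<in> torus"
  shows "distr (\<Pi>\<^sub>M j\<in>UNIV. circle_measure) (\<Pi>\<^sub>M j\<in>UNIV. circle_measure) (\<lambda>z. torus_mult z w)
    = (\<Pi>\<^sub>M j\<in>UNIV. circle_measure)"
proof -
  let ?\<Pi> = "\<Pi>\<^sub>M j\<in>(UNIV :: nat set). circle_measure"
  interpret product_prob_space "\<lambda>_::nat. circle_measure" UNIV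
    by (rule product_prob_spaceI) (rule prob_space_circle_measure)
  have w1: "norm (w j) = 1" for j using w by (auto simp: torus_def)
  note rot [measurable] = rotation_measurable[OF w1]
  have mult [measurable]: "(\<lambda>z. torus_mult z w) \<in> ?\<Pi> \<rightarrow>\<^sub>M ?\<Pi>"
    unfolding torus_mult_def
    by (rule measurable_PiM_single')
       (auto simp: space_PiM space_circle_measure norm_mult w1
         intro!: measurable_compose[where f = "\<lambda>z. z _", OF _ rot])
  show ?thesis
  proof (rule PiM_eq)
    fix J :: "nat set" and F :: "nat \<Rightarrow> complex set"
    assume J: "finite J" "J \<subseteq> UNIV" and F: "\<And>j. j \<in> J \<Longrightarrow> F j \<in> sets circle_measure"
    define R where "R j = (\<lambda>z. z * w j) -` F j \<inter> space circle_measure" for j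
    have R: "R j \<in> sets circle_measure" if "j \<in> J" for j
      unfolding R_def using rot F[OF that] by (rule measurable_sets)
    have R_eq: "emeasure circle_measure (R j) = emeasure circle_measure (F j)" if "j \<in> J" for j
      unfolding R_def using F[OF that]
      by (subst (2) distr_rotation_circle_measure[OF w1[of j], symmetric]) (simp add: emeasure_distr)
    have "(\<lambda>z. torus_mult z w) -` prod_emb UNIV (\<lambda>_. circle_measure) J (Pi\<^sub>E J F) \<inter> space ?\<Pi>
        = prod_emb UNIV (\<lambda>_. circle_measure) J (Pi\<^sub>E J R)"
      by (auto simp: prod_emb_def space_PiM R_def torus_mult_def space_circle_measure norm_mult w1
        PiE_iff restrict_def extensional_def split: if_splits)
    then have "emeasure (distr ?\<Pi> ?\<Pi> (\<lambda>z. torus_mult z w)) (prod_emb UNIV (\<lambda>_. circle_measure) J (Pi\<^sub>E J F))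
        = emeasure ?\<Pi> (prod_emb UNIV (\<lambda>_. circle_measure) J (Pi\<^sub>E J R))"
      using J F by (subst emeasure_distr) (auto intro!: sets_PiM_I)
    also have "\<dots> = (\<Prod>j\<in>J. emeasure circle_measure (R j))"
      using J R by (intro emeasure_PiM_emb) auto
    also have "\<dots> = (\<Prod>j\<in>J. emeasure circle_measure (F j))"
      by (intro prod.cong) (auto simp: R_eq)
    finally show "emeasure (distr ?\<Pi> ?\<Pi> (\<lambda>z. torus_mult z w)) (prod_emb UNIV (\<lambda>_. circle_measure) J (\<Pi>\<^sub>E j\<in>J. F j))
        = (\<Prod>j\<in>J. emeasure circle_measure (F j))" .
  qed simp
qed

lemma enumerate_primes_pos: "enumerate {p::nat. prime p} j > 0"
  using enumerate_in_set[OF primes_infinite, of j] by (auto intro: prime_gt_0_nat)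

lemma kronecker_flow_add: "kronecker_flow (s + t) j = kronecker_flow s j * kronecker_flow t j"
  by (simp add: kronecker_flow_def algebra_simps flip: powr_add)

lemma kronecker_flow_0: "kronecker_flow 0 j = 1"
  using enumerate_primes_pos[of j] by (simp add: kronecker_flow_def)

lemma kronecker_flow_measurable: "(\<lambda>t. kronecker_flow t j) \<in> borel_measurable borel"
  unfolding kronecker_flow_def using enumerate_primes_pos[of j]
  by (intro borel_measurable_continuous_onI continuous_intros) auto

lemma prime_flow_measure_preserving:
  "measure_preserving_flow (\<Pi>\<^sub>M j\<in>UNIV. circle_measure) (\<lambda>t z. torus_mult z (kronecker_flow t))"
proof -
  let ?\<Pi> = "\<Pi>\<^sub>M j\<in>(UNIV :: nat set). circle_measure"
  interpret product_prob_space "\<lambda>_::nat. circle_measure" UNIV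
    by (rule product_prob_spaceI) (rule prob_space_circle_measure)
  have norm_flow: "norm (kronecker_flow t j) = 1" for t j
    using kronecker_flow_in_torus[of t] by (auto simp: torus_def)
  show ?thesis
  proof
    show "(\<lambda>(t, z). torus_mult z (kronecker_flow t)) \<in> borel \<Otimes>\<^sub>M ?\<Pi> \<rightarrow>\<^sub>M ?\<Pi>"
      unfolding torus_mult_def case_prod_beta
    proof (rule measurable_PiM_single')
      fix j :: nat
      note [measurable] = kronecker_flow_measurable
      have "(\<lambda>z. z j) \<in> ?\<Pi> \<rightarrow>\<^sub>M circle_measure" by simp
      then have [measurable]: "(\<lambda>z. z j) \<in> borel_measurable ?\<Pi>"
        by (simp add: measurable_cong_sets[OF refl sets_circle_measure] measurable_restrict_space2_iff)
      have "(\<lambda>x. snd x j * kronecker_flow (fst x) j) \<in> borel \<Otimes>\<^sub>M ?\<Pi> \<rightarrow>\<^sub>M restrict_space borel (sphere 0 1)"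
        by (intro measurable_restrict_space2)
           (auto simp: space_pair_measure space_PiM space_circle_measure norm_mult norm_flow)
      then show "(\<lambda>x. snd x j * kronecker_flow (fst x) j) \<in> borel \<Otimes>\<^sub>M ?\<Pi> \<rightarrow>\<^sub>M circle_measure"
        by (simp add: measurable_cong_sets[OF refl sets_circle_measure])
    qed (auto simp: space_pair_measure space_PiM space_circle_measure norm_mult norm_flow)
    show "distr ?\<Pi> ?\<Pi> (\<lambda>z. torus_mult z (kronecker_flow t)) = ?\<Pi>" for t
      by (rule distr_torus_mult[OF kronecker_flow_in_torus])
  qed (simp_all add: torus_mult_def kronecker_flow_add kronecker_flow_0 mult_ac)
qed

theorem theorem3p2:
  fixes F :: "nat \<Rightarrow> (nat \<Rightarrow> complex) \<Rightarrow> ennreal"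
    and F_lim :: "(nat \<Rightarrow> complex) \<Rightarrow> ennreal"
  assumes measurable: "\<And>n. F n \<in> borel_measurable torus_haar"
    and nondecreasing: "\<And>z. z \<in> torus \<Longrightarrow> incseq (\<lambda>n. F n z)"
    and limit: "\<And>z. z \<in> torus \<Longrightarrow> (\<lambda>n. F n z) \<longlonglongrightarrow> F_lim z"
  shows "AE z in torus_haar.
    (\<forall>n. (\<lambda>t. F n (torus_mult z (kronecker_flow t))) \<in> borel_measurable lebesgue) \<and>
    (\<lambda>t. F_lim (torus_mult z (kronecker_flow t))) \<in> borel_measurable lebesgue \<and>
    (\<exists>l L. (\<forall>n. (flow_mean (F n) z \<longlongrightarrow> l n) at_top) \<and>
           l \<longlonglongrightarrow> L \<and>
           (flow_mean F_lim z \<longlongrightarrow> L) at_top)"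
proof -
  have space: "space (\<Pi>\<^sub>M j\<in>UNIV. circle_measure) = torus"
    by (simp add: torus_def space_PiM space_circle_measure)
  show ?thesis
    using measure_preserving_flow.AE_convergent_means_completion[OF prime_flow_measure_preserving,
        of F F_lim] assms
    unfolding torus_haar_def flow_mean_def[abs_def] space by blast
qed

end
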